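(* Let $d \ge 1$, let $K_1, K_2$ be convex sets in $\mathbb{R}^d$, and let $\mathcal{C}$ be the strong cover of $S = \mathbb{R}^d \setminus (K_1 \cup K_2)$. Then any two flats $I, J \in \mathcal{C}$ satisfy $J \subset I$ or $I \subset J$. Consequently, $\mathcal{C}$ contains at most one $k$-flat for each $0 \le k \le d$. Moreover, for any subset $T$ of $\{0, 1, \ldots, d\}$ there exist convex sets $K_1, K_2 \subset \mathbb{R}^d$ such that the strong cover $\mathcal{C}$ of $\mathbb{R}^d \setminus (K_1 \cup K_2)$ contains a $k$-flat if and only if $k \in T$.
   Context: A flat is an affine subspace of $\mathbb{R}^d$; a $k$-flat is a $k$-dimensional affine subspace. $B(p,\epsilon)$ is the open ball of radius $\epsilon$ centered at $p$. For $k \ge -1$, a $k$-simplex is the convex hull of $k+1$ affinely independent points of $\mathbb{R}^d$. For $S \subset \mathbb{R}^d$, the flat-dimension is $dm(S) = \max\{k : S \text{ includes a } k\text{-simplex}\}$ (so $dm(\emptyset)=-1$). For $p \in S$, the local dimension of $S$ at $p$ is $dm(S,p) = \min_{\epsilon > 0} dm(S \cap B(p,\epsilon))$. A strong cover of $S$ is a finite collection $\mathcal{C}$ of flats such that each $p \in S$ belongs to some flat of $\mathcal{C}$ of dimension $dm(S,p)$, and no proper subcollection of $\mathcal{C}$ has this property. For $S$ the complement in $\mathbb{R}^d$ of a finite union of convex sets, $S$ has a unique strong cover $\mathcal{C}$; it equals the collection of all ordinary flats of $S$, where a $k$-flat $H$ is ($k$-)ordinary for $S$ if there are a point $p \in S$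 with $dm(S,p)=k$ and an open neighborhood $U$ of $p$ with $S \cap U = H \cap U$. *)

theory Defs
  imports "HOL-Analysis.Analysis"
begin

definition is_flat :: "int \<Rightarrow> 'a::euclidean_space set \<Rightarrow> bool" where
  "is_flat k F \<longleftrightarrow> affine F \<and> aff_dim F = k"

(* The library's "k simplex P" is the convex hull of k + 1 affinely independent points;
   k is an int, and the (-1)-simplex is the empty set. *)

definition flat_dims :: "'a::euclidean_space set \<Rightarrow> int set" where
  "flat_dims S = {k. \<exists>P. k simplex P \<and> P \<subseteq> S}"

definition flat_dim :: "'a::euclidean_space set \<Rightarrow> int" where
  "flat_dim S = Max (flat_dims S)"

definition local_dims :: "'a::euclidean_space set \<Rightarrow> 'a \<Rightarrow> int set" where
  "local_dims S p = {flat_dim (S \<inter> ball p e) |e. e > 0}"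

definition local_dim :: "'a::euclidean_space set \<Rightarrow> 'a \<Rightarrow> int" where
  "local_dim S p = Min (local_dims S p)"

definition covers_strongly :: "'a::euclidean_space set set \<Rightarrow> 'a set \<Rightarrow> bool" where
  "covers_strongly C S \<longleftrightarrow> (\<forall>p\<in>S. \<exists>F\<in>C. p \<in> F \<and> is_flat (local_dim S p) F)"

definition strong_cover :: "'a::euclidean_space set set \<Rightarrow> 'a set \<Rightarrow> bool" where
  "strong_cover C S \<longleftrightarrow>
     finite C \<and> (\<forall>F\<in>C. affine F) \<and> covers_strongly C S \<and>
     (\<forall>D. D \<subset> C \<longrightarrow> \<not> covers_strongly D S)"

(* Max and Min above range over finite nonempty sets. *)

lemma flat_dims_subset:
  fixes S :: "'a::euclidean_space set"
  shows "flat_dims S \<subseteq> {-1..int DIM('a)}"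
proof
  fix k assume "k \<in> flat_dims S"
  then obtain P :: "'a set" where "k simplex P"
    by (auto simp: flat_dims_def)
  then have "aff_dim P = k"
    by (rule aff_dim_simplex)
  then show "k \<in> {-1..int DIM('a)}"
    using aff_dim_geq[of P] aff_dim_le_DIM[of P] by auto
qed

lemma finite_flat_dims: "finite (flat_dims S)"
  by (rule finite_subset[OF flat_dims_subset]) simp

lemma flat_dims_nonempty: "flat_dims S \<noteq> {}"
proof -
  have "-1 \<in> flat_dims S"
    by (simp add: flat_dims_def)
  then show ?thesis by auto
qed

lemma flat_dim_in: "flat_dim S \<in> flat_dims S"
  unfolding flat_dim_def by (rule Max_in[OF finite_flat_dims flat_dims_nonempty])

lemma finite_local_dims:
  fixes S :: "'a::euclidean_space set"
  shows "finite (local_dims S p)"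
proof (rule finite_subset)
  show "local_dims S p \<subseteq> {-1..int DIM('a)}"
  proof
    fix k assume "k \<in> local_dims S p"
    then obtain e where "k = flat_dim (S \<inter> ball p e)"
      by (auto simp: local_dims_def)
    then show "k \<in> {-1..int DIM('a)}"
      using subsetD[OF flat_dims_subset flat_dim_in] by simp
  qed
qed simp

lemma local_dims_nonempty: "local_dims S p \<noteq> {}"
proof -
  have "flat_dim (S \<inter> ball p 1) \<in> local_dims S p"
    unfolding local_dims_def by (rule CollectI, rule exI[of _ 1]) simp
  then show ?thesis by auto
qed

end

theory Submission
  imports Defs
begin

text \<open>
  If neither of two flats \<open>I\<close>, \<open>J\<close> of the strong cover contains the other, there are points
  \<open>p \<in> I - J\<close> and \<open>q \<in> J - I\<close> of \<open>S\<close> near which \<open>S\<close> lies in \<open>I\<close> and in \<open>J\<close>, respectively.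
  The line through \<open>p\<close> and \<open>q\<close> then meets \<open>S\<close> in isolated points at \<open>p\<close> and \<open>q\<close>. Choose points of the
  line just before \<open>p\<close>, just after \<open>p\<close> and just after \<open>q\<close>: two of the three belong to the same convex
  set, which therefore contains \<open>p\<close> or \<open>q\<close>, a contradiction.

  For the existence part, take a complete flag of coordinate subspaces \<open>V\<^sub>k\<close>. Let \<open>K2\<close> consist of the
  vectors whose last nonzero coordinate is negative, and \<open>K1\<close> of those for which it is positive and,
  when its index \<open>k\<close> lies in \<open>T\<close>, less than 1. What remains are the pieces \<open>{x \<in> V\<^sub>k. x\<^sub>k \<ge> 1}\<close> with
  \<open>k \<in> T\<close>, at mutual distance at least 1.
\<close>

section \<open>Finite affine covers of convex sets, and flat-dimension\<close>

text \<open>If no flat contains \<open>A\<close>, take \<open>x\<close> in \<open>A\<close> off the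
  older flats and \<open>y\<close> in \<open>A\<close> off the new flat \<open>F\<close>. As the
  older flats are closed, points of the segment close to \<open>x\<close> avoid them and lie in
  \<open>F\<close>, which forces \<open>y\<close> into \<open>F\<close> as well.\<close>

lemma convex_subset_Union_affine:
  fixes A :: "'a::euclidean_space set"
  assumes "finite \<F>" "convex A" "A \<noteq> {}"
    and "\<And>F. F \<in> \<F> \<Longrightarrow> affine F" "A \<subseteq> \<Union>\<F>"
  shows "\<exists>F\<in>\<F>. A \<subseteq> F"
  using assms(1,4,5)
proof (induction \<F> rule: finite_induct)
  case empty
  then show ?case using assms(3) by auto
next
  case (insert F \<F>)
  show ?case
  proof (rule ccontr)
    assume none: "\<not> (\<exists>F\<in>insert F \<F>. A \<subseteq> F)"
    then obtain x where x: "x \<in> A" "x \<notin> \<Union>\<F>"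
      using insert by (metis insertCI subsetI)
    with insert.prems have "x \<in> F" by auto
    obtain y where y: "y \<in> A" "y \<notin> F"
      using none by auto
    have "open (- \<Union>\<F>)"
      using insert by (intro open_Compl closed_Union) (auto intro: affine_closed)
    moreover have "((\<lambda>t. (1 - t) *\<^sub>R x + t *\<^sub>R y) \<longlongrightarrow> (1 - 0) *\<^sub>R x + 0 *\<^sub>R y) (at_right 0)"
      by (intro tendsto_intros)
    ultimately have "\<forall>\<^sub>F t in at_right (0::real). (1 - t) *\<^sub>R x + t *\<^sub>R y \<in> - \<Union>\<F>"
      using x(2) by (intro topological_tendstoD) auto
    then obtain e where e: "e > 0"
      "\<And>t. 0 < t \<Longrightarrow> t < e \<Longrightarrow> (1 - t) *\<^sub>R x + t *\<^sub>R y \<notin> \<Union>\<F>"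
      by (auto simp: eventually_at_right_field)
    define t where "t = min (e / 2) 1"
    have t: "0 < t" "t < e" "t \<le> 1"
      using e(1) by (auto simp: t_def)
    define z where "z = (1 - t) *\<^sub>R x + t *\<^sub>R y"
    have "z \<in> A"
      unfolding z_def using \<open>convex A\<close> x y t by (intro convexD_alt) auto
    moreover have "z \<notin> \<Union>\<F>"
      using e t by (simp add: z_def)
    ultimately have "z \<in> F"
      using insert.prems(2) by auto
    \<comment> \<open>Solving the definition of \<open>z\<close> for \<open>y\<close> places
      \<open>y\<close> on the line through \<open>x\<close> and \<open>z\<close>.\<close>
    have "(1 - 1 / t) *\<^sub>R x + (1 / t) *\<^sub>R z \<in> F"
      using insert.prems(1)[of F] \<open>x \<in> F\<close> \<open>z \<in> F\<close> by (auto intro!: mem_affine)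
    also have "(1 - 1 / t) *\<^sub>R x + (1 / t) *\<^sub>R z = y"
      using t by (simp add: z_def algebra_simps divide_simps flip: scaleR_add_left)
    finally show False
      using y by simp
  qed
qed

lemma flat_dim_ge: "k simplex P \<Longrightarrow> P \<subseteq> S \<Longrightarrow> k \<le> flat_dim S"
  unfolding flat_dim_def by (intro Max_ge finite_flat_dims) (auto simp: flat_dims_def)

lemma flat_dim_attained: "\<exists>P. flat_dim S simplex P \<and> P \<subseteq> S"
  using flat_dim_in[of S] by (simp add: flat_dims_def)

lemma flat_dim_mono: "S \<subseteq> T \<Longrightarrow> flat_dim S \<le> flat_dim T"
  using flat_dim_attained[of S] flat_dim_ge by (metis order_trans)

lemma local_dim_le: "e > 0 \<Longrightarrow> local_dim S p \<le> flat_dim (S \<inter> ball p e)"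
  unfolding local_dim_def by (intro Min_le finite_local_dims) (auto simp: local_dims_def)

lemma local_dim_attained: "\<exists>e>0. local_dim S p = flat_dim (S \<inter> ball p e)"
  using Min_in[OF finite_local_dims local_dims_nonempty, of S p]
  unfolding local_dim_def local_dims_def by auto

text \<open>Convexity keeps the hull of an affine basis of \<open>S\<close> inside \<open>S\<close>,
  and this hull is a simplex of full dimension.\<close>

lemma flat_dim_convex:
  fixes S :: "'a::euclidean_space set"
  assumes "convex S"
  shows "flat_dim S = aff_dim S"
proof (rule antisym)
  obtain P where P: "flat_dim S simplex P" "P \<subseteq> S"
    using flat_dim_attained by blast
  then show "flat_dim S \<le> aff_dim S"
    using aff_dim_simplex aff_dim_subset by metis
next
  obtain B where B: "\<not> affine_dependent B" "B \<subseteq> S" "affine hull B = affine hull S"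
    using affine_basis_exists[of S] by auto
  then have "aff_dim S = aff_dim B"
    by (metis aff_dim_affine_hull)
  then have "aff_dim S simplex (convex hull B)"
    using B aff_dim_affine_independent[OF B(1)] by (auto simp: simplex_def)
  moreover have "convex hull B \<subseteq> S"
    using B assms by (simp add: hull_minimal)
  ultimately show "aff_dim S \<le> flat_dim S"
    by (rule flat_dim_ge)
qed

section \<open>Points at which a flat of a strong cover is indispensable\<close>

text \<open>By minimality, dropping \<open>I\<close> leaves some point uncovered; there
  \<open>I\<close> is the only eligible flat.\<close>

lemma strong_cover_essential_point:
  assumes "strong_cover C S" "I \<in> C"
  shows "\<exists>p\<in>S. p \<in> I \<and> aff_dim I = local_dim S p \<and>
           (\<forall>F\<in>C. p \<in> F \<and> aff_dim F = local_dim S p \<longrightarrow> F = I)"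
proof -
  have "\<not> covers_strongly (C - {I}) S"
    using assms unfolding strong_cover_def by auto
  then obtain p where p: "p \<in> S" "\<not> (\<exists>F\<in>C - {I}. p \<in> F \<and> is_flat (local_dim S p) F)"
    unfolding covers_strongly_def by blast
  moreover have "\<exists>F\<in>C. p \<in> F \<and> is_flat (local_dim S p) F"
    using assms p(1) unfolding strong_cover_def covers_strongly_def by blast
  moreover have "affine F" if "F \<in> C" for F
    using assms that by (auto simp: strong_cover_def)
  ultimately show ?thesis
    unfolding is_flat_def by blast
qed

text \<open>
  The point is found inside a simplex of maximal dimension near an essential point of \<open>I\<close>, away from
  the lower-dimensional members of the cover.
\<close>
lemma strong_cover_locally_in_flat:
  fixes S :: "'a::euclidean_space set"
  assumes "strong_cover C S" "I \<in> C" "affine J" "\<not> I \<subseteq> J"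
  shows "\<exists>p\<in>S. \<exists>e>0. p \<in> I \<and> p \<notin> J \<and> S \<inter> ball p e \<subseteq> I"
proof -
  have C: "finite C" "\<And>F. F \<in> C \<Longrightarrow> affine F" "covers_strongly C S"
    using assms(1) by (auto simp: strong_cover_def)
  obtain p where p: "p \<in> S" "p \<in> I" "aff_dim I = local_dim S p"
    and p_only: "\<And>F. F \<in> C \<Longrightarrow> p \<in> F \<Longrightarrow> aff_dim F = local_dim S p \<Longrightarrow> F = I"
    using strong_cover_essential_point[OF assms(1,2)] by blast
  have away: "\<exists>e>0. ball p e \<inter> \<Union>{F \<in> C. p \<notin> F} = {}" for p
  proof -
    have "closed (\<Union>{F \<in> C. p \<notin> F})"
      using C by (intro closed_Union) (auto intro: affine_closed)
    then have "open (- \<Union>{F \<in> C. p \<notin> F})" by (simp add: open_closed)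
    then obtain e where "e > 0" "ball p e \<subseteq> - \<Union>{F \<in> C. p \<notin> F}"
      by (rule openE) auto
    then show ?thesis by blast
  qed
  obtain e1 where e1: "e1 > 0" "local_dim S p = flat_dim (S \<inter> ball p e1)"
    using local_dim_attained by blast
  obtain e2 where e2: "e2 > 0" "ball p e2 \<inter> \<Union>{F \<in> C. p \<notin> F} = {}"
    using away by blast
  define e where "e = min e1 e2"
  have e: "e > 0" "ball p e \<subseteq> ball p e1" "ball p e \<subseteq> ball p e2"
    using e1 e2 by (auto simp: e_def)
  \<comment> \<open>Near \<open>p\<close> local dimensions cannot exceed that at \<open>p\<close>,
    and the choice of \<open>e2\<close> excludes flats missing \<open>p\<close>.\<close>
  have cover: "\<exists>F\<in>C. q \<in> F \<and> p \<in> F \<and> aff_dim F \<le> aff_dim I"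
    if q: "q \<in> S" "q \<in> ball p e" for q
  proof -
    obtain F where F: "F \<in> C" "q \<in> F" "is_flat (local_dim S q) F"
      using C(3) q(1) unfolding covers_strongly_def by blast
    obtain r where r: "r > 0" "ball q r \<subseteq> ball p e"
      using q(2) by (rule openE[OF open_ball])
    have "local_dim S q \<le> flat_dim (S \<inter> ball q r)"
      using r(1) by (rule local_dim_le)
    also have "\<dots> \<le> flat_dim (S \<inter> ball p e1)"
      using r e by (intro flat_dim_mono) blast
    finally have "aff_dim F \<le> aff_dim I"
      using F p e1 by (simp add: is_flat_def)
    moreover have "p \<in> F"
      using F q e e2 by blast
    ultimately show ?thesis
      using F by auto
  qed
  have "flat_dim (S \<inter> ball p e) = aff_dim I"
    using local_dim_le[OF e(1), of S p] flat_dim_mono[of "S \<inter> ball p e" "S \<inter> ball p e1"] e e1 p(3)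
    by (metis Int_mono order.antisym order_refl)
  then obtain P where P: "aff_dim I simplex P" "P \<subseteq> S \<inter> ball p e"
    using flat_dim_attained[of "S \<inter> ball p e"] by auto
  have "aff_dim I \<ge> 0"
    using p(2) by (metis aff_dim_negative_iff empty_iff not_le)
  then have P_props: "convex P" "P \<noteq> {}" "aff_dim P = aff_dim I"
    using P(1) aff_dim_simplex[OF P(1)] by (auto simp: simplex_def)
  \<comment> \<open>A single flat of the cover contains all of \<open>P\<close>; it then has the
    dimension of \<open>I\<close> and passes through \<open>p\<close>, so it is
    \<open>I\<close>.\<close>
  have "\<exists>F\<in>{F \<in> C. p \<in> F \<and> aff_dim F \<le> aff_dim I}. P \<subseteq> F"
  proof (rule convex_subset_Union_affine)
    show "P \<subseteq> \<Union>{F \<in> C. p \<in> F \<and> aff_dim F \<le> aff_dim I}"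
      using cover P(2) by blast
  qed (use C P_props in auto)
  then obtain F where F: "F \<in> C" "p \<in> F" "aff_dim F \<le> aff_dim I" "P \<subseteq> F"
    by auto
  have "F = I"
    using F P_props aff_dim_subset[OF F(4)] p p_only by auto
  with F have "P \<subseteq> I" by simp
  \<comment> \<open>Otherwise one of these flats contains all of \<open>P\<close>. The
    lower-dimensional ones are too small, and \<open>J\<close> would contain
    \<open>affine hull P\<close>, which is \<open>I\<close>.\<close>
  have "\<not> P \<subseteq> \<Union>(insert J {F \<in> C. aff_dim F < aff_dim I})"
  proof
    assume "P \<subseteq> \<Union>(insert J {F \<in> C. aff_dim F < aff_dim I})"
    then have "\<exists>F\<in>insert J {F \<in> C. aff_dim F < aff_dim I}. P \<subseteq> F"
      using C P_props assms(3) by (intro convex_subset_Union_affine) auto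
    then consider "P \<subseteq> J" | F where "aff_dim F < aff_dim I" "P \<subseteq> F"
      by auto
    then show False
    proof cases
      case 1
      have "affine hull P = I"
        using \<open>P \<subseteq> I\<close> P_props C(2)[OF assms(2)]
        by (intro affine_dim_equal) (auto simp: hull_minimal)
      then show False
        using 1 assms(3,4) by (metis hull_minimal)
    next
      case 2
      then show False
        using aff_dim_subset[of P F] P_props by simp
    qed
  qed
  then obtain q where q: "q \<in> P" "q \<notin> J" "\<And>F. F \<in> C \<Longrightarrow> aff_dim F < aff_dim I \<Longrightarrow> q \<notin> F"
    by auto
  obtain r1 where r1: "r1 > 0" "ball q r1 \<subseteq> ball p e"
    by (rule openE[OF open_ball, of q p e]) (use q(1) P(2) in auto)
  obtain r2 where r2: "r2 > 0" "ball q r2 \<inter> \<Union>{F \<in> C. q \<notin> F} = {}"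
    using away by blast
  define r where "r = min r1 r2"
  have r: "r > 0" "ball q r \<subseteq> ball q r1" "ball q r \<subseteq> ball q r2"
    using r1 r2 by (auto simp: r_def)
  \<comment> \<open>A flat supplied by \<open>cover\<close> at a point this close to
    \<open>q\<close> passes through \<open>p\<close> and \<open>q\<close>. Since \<open>q\<close>
    avoids the lower-dimensional flats, it has the dimension of \<open>I\<close> and hence equals
    \<open>I\<close>.\<close>
  have "S \<inter> ball q r \<subseteq> I"
  proof
    fix x assume x: "x \<in> S \<inter> ball q r"
    then obtain F where F: "F \<in> C" "x \<in> F" "p \<in> F" "aff_dim F \<le> aff_dim I"
      using cover r r1 by blast
    then have "q \<in> F"
      using x r r2 by blast
    then have "aff_dim F = aff_dim I"
      using q(3) F by fastforce
    then show "x \<in> I"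
      using F p p_only by auto
  qed
  then show ?thesis
    using q P(2) \<open>P \<subseteq> I\<close> r(1) by blast
qed

section \<open>The chain property for two convex sets\<close>

text \<open>A second common point would put the whole line, and with it \<open>q\<close>, into
  \<open>F\<close>.\<close>

lemma affine_line_meets_once:
  fixes F :: "'a::real_vector set"
  assumes "affine F" "p \<in> F" "q \<notin> F" "p + t *\<^sub>R (q - p) \<in> F"
  shows "t = 0"
proof (rule ccontr)
  assume "t \<noteq> 0"
  have "(1 - 1 / t) *\<^sub>R p + (1 / t) *\<^sub>R (p + t *\<^sub>R (q - p)) \<in> F"
    using assms by (intro mem_affine) auto
  also have "(1 - 1 / t) *\<^sub>R p + (1 / t) *\<^sub>R (p + t *\<^sub>R (q - p)) = q"
    using \<open>t \<noteq> 0\<close> by (simp add: algebra_simps)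
  finally show False using assms by simp
qed

lemma strong_cover_two_convex_chain:
  fixes K1 K2 :: "'a::euclidean_space set"
  assumes "convex K1" "convex K2" and C: "strong_cover C (UNIV - (K1 \<union> K2))"
    and "I \<in> C" "J \<in> C"
  shows "J \<subseteq> I \<or> I \<subseteq> J"
proof (rule ccontr)
  assume "\<not> (J \<subseteq> I \<or> I \<subseteq> J)"
  moreover have aff: "affine I" "affine J"
    using assms by (auto simp: strong_cover_def)
  ultimately obtain p q e1 e2 where
    p: "p \<notin> K1 \<union> K2" "p \<in> I" "p \<notin> J" and e1: "e1 > 0" "ball p e1 - I \<subseteq> K1 \<union> K2" and
    q: "q \<notin> K1 \<union> K2" "q \<in> J" "q \<notin> I" and e2: "e2 > 0" "ball q e2 - J \<subseteq> K1 \<union> K2"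
    using strong_cover_locally_in_flat[OF C, of I J] strong_cover_locally_in_flat[OF C, of J I] assms
    by blast
  define n where "n = norm (q - p)"
  have n: "n > 0"
    using p q by (auto simp: n_def)
  \<comment> \<open>The bound 1/2 gives \<open>- t < 0 < t < 1 < 1 + t\<close>; the other two keep
    the displacement \<open>t * n\<close> strictly below both radii.\<close>
  define t where "t = min (1 / 2) (min (e1 / (2 * n)) (e2 / (2 * n)))"
  have t: "0 < t" "t < 1" "t * n < e1" "t * n < e2"
  proof -
    show "0 < t" "t < 1"
      using n e1 e2 by (auto simp: t_def)
    have "t \<le> e1 / (2 * n)" "t \<le> e2 / (2 * n)"
      by (auto simp: t_def)
    then have "t * n \<le> e1 / 2" "t * n \<le> e2 / 2"
      using n by (auto simp: field_simps)
    then show "t * n < e1" "t * n < e2"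
      using e1 e2 by auto
  qed
  define z where "z s = p + s *\<^sub>R (q - p)" for s
  have z: "z s \<in> K1 \<union> K2" if s: "s \<in> {-t, t}" for s
  proof -
    have "dist p (z s) < e1"
      using s t by (auto simp: z_def dist_norm n_def)
    moreover have "z s \<notin> I"
      using affine_line_meets_once[OF aff(1) p(2) q(3), of s] s t by (auto simp: z_def)
    ultimately show ?thesis
      using e1 by auto
  qed
  have z': "z (1 + t) \<in> K1 \<union> K2"
  proof -
    \<comment> \<open>Parametrised from \<open>q\<close> towards \<open>p\<close>, so that the
      argument at \<open>p\<close> applies with the roles exchanged.\<close>
    have eq: "z (1 + t) = q + (- t) *\<^sub>R (p - q)"
      by (simp add: z_def algebra_simps)
    then have "dist q (z (1 + t)) < e2"
      using t by (auto simp: dist_norm n_def norm_minus_commute)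
    moreover have "z (1 + t) \<notin> J"
      using affine_line_meets_once[OF aff(2) q(2) p(3), of "- t"] t unfolding eq by auto
    ultimately show ?thesis
      using e2 by auto
  qed
  have between: "z b \<in> K" if "convex K" "z a \<in> K" "z c \<in> K" "a < b" "b < c" for a b c K
  proof -
    define u where "u = (b - a) / (c - a)"
    have u: "0 \<le> u" "u \<le> 1" "(1 - u) * a + u * c = b"
      using that by (auto simp: u_def divide_simps) (auto simp: algebra_simps)
    have "z b = (1 - u) *\<^sub>R z a + u *\<^sub>R z c"
      unfolding z_def u(3)[symmetric] by (simp add: algebra_simps)
    then show ?thesis
      using that u by (simp add: convexD_alt)
  qed
  \<comment> \<open>\<open>p\<close> separates \<open>z (- t)\<close> from the other two points, and
    \<open>q\<close> separates \<open>z t\<close> from \<open>z (1 + t)\<close>. So each convex set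
    holds at most one of three points that the two sets must cover.\<close>
  have "p = z 0" "q = z 1"
    by (auto simp: z_def)
  then have gap: "\<not> (z (- t) \<in> K \<and> z t \<in> K)" "\<not> (z (- t) \<in> K \<and> z (1 + t) \<in> K)"
    "\<not> (z t \<in> K \<and> z (1 + t) \<in> K)" if "K \<in> {K1, K2}" for K
    using that p(1) q(1) assms(1,2) t between[of K "- t" t 0] between[of K "- t" "1 + t" 0]
      between[of K t "1 + t" 1] by auto
  show False
    using gap[of K1] gap[of K2] z[of t] z[of "- t"] z' by blast
qed

section \<open>Coordinate flags and sets given by leading coordinates\<close>

locale basis_enumeration =
  fixes b :: "nat \<Rightarrow> 'a::euclidean_space"
  assumes b_bij: "bij_betw b {1..DIM('a)} Basis"
begin

text \<open>The constant zeroth coordinate makes the origin behave like the other members of the flag.\<close>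
definition coord :: "nat \<Rightarrow> 'a \<Rightarrow> real" where
  "coord i x = (if i = 0 then 1 else x \<bullet> b i)"

text \<open>For \<open>k \<le> DIM('a)\<close> this is the span of \<open>b 1\<close>, ...,
  \<open>b k\<close>; \<open>flag 0\<close> is the origin.\<close>

definition flag :: "nat \<Rightarrow> 'a set" where
  "flag k = {x. \<forall>i\<in>{k<..DIM('a)}. coord i x = 0}"

text \<open>When no \<open>J k\<close> contains 0, the index \<open>k\<close> can only be that of
  the last nonzero coordinate, so membership tests the leading value alone.\<close>

definition leading :: "(nat \<Rightarrow> real set) \<Rightarrow> 'a set" where
  "leading J = (\<Union>k\<le>DIM('a). flag k \<inter> {x. coord k x \<in> J k})"

lemma coord_convex_comb:
  "u + v = 1 \<Longrightarrow> coord i (u *\<^sub>R x + v *\<^sub>R y) = u * coord i x + v * coord i y"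
  by (simp add: coord_def inner_left_distrib)

lemma flag_eq_substandard:
  assumes "k \<le> DIM('a)"
  shows "flag k = {x. \<forall>i\<in>Basis. i \<notin> b ` {1..k} \<longrightarrow> x \<bullet> i = 0}"
proof -
  have inj: "inj_on b {1..DIM('a)}" and im: "b ` {1..DIM('a)} = Basis"
    using b_bij by (auto simp: bij_betw_def)
  have "b ` {k<..DIM('a)} = Basis - b ` {1..k}"
  proof -
    have "{k<..DIM('a)} = {1..DIM('a)} - {1..k}"
      using assms by auto
    then show ?thesis
      using inj_on_image_set_diff[OF inj, of "{1..DIM('a)}" "{1..k}"] assms im by auto
  qed
  then have "flag k = {x. \<forall>i\<in>Basis - b ` {1..k}. x \<bullet> i = 0}"
    unfolding flag_def coord_def unfolding \<open>b ` {k<..DIM('a)} = _\<close>[symmetric] by auto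
  then show ?thesis by auto
qed

lemma
  assumes "k \<le> DIM('a)"
  shows affine_flag: "affine (flag k)" and aff_dim_flag: "aff_dim (flag k) = int k"
proof -
  have inj: "inj_on b {1..k}" and im: "b ` {1..k} \<subseteq> Basis"
    using b_bij assms by (auto simp: bij_betw_def intro: inj_on_subset)
  have sub: "subspace (flag k)"
    unfolding flag_eq_substandard[OF assms] by (rule subspace_substandard)
  then show "affine (flag k)"
    by (rule subspace_imp_affine)
  have "dim (flag k) = k"
    unfolding flag_eq_substandard[OF assms] using dim_substandard[OF im] inj by (simp add: card_image)
  then show "aff_dim (flag k) = int k"
    using sub by (simp add: aff_dim_subspace)
qed

text \<open>The largest index of a nonzero coordinate serves; coordinate 0 guarantees that there is
  one.\<close>

lemma leading_exists:
  "\<exists>k\<le>DIM('a). x \<in> flag k \<and> coord k x \<noteq> 0"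
proof -
  let ?A = "{k. k \<le> DIM('a) \<and> coord k x \<noteq> 0}"
  have fin: "finite ?A" by simp
  have "0 \<in> ?A" by (simp add: coord_def)
  then have "Max ?A \<in> ?A"
    using Max_in[OF fin] by blast
  moreover have "x \<in> flag (Max ?A)"
    unfolding flag_def using Max_ge[OF fin] by (fastforce simp: not_le[symmetric])
  ultimately show ?thesis by blast
qed

lemma leading_unique:
  assumes "k \<le> DIM('a)" "l \<le> DIM('a)" "x \<in> flag k" "x \<in> flag l" "coord k x \<noteq> 0" "coord l x \<noteq> 0"
  shows "k = l"
proof (rule ccontr)
  assume "k \<noteq> l"
  then show False
    using assms unfolding flag_def by (cases "k < l") auto
qed

text \<open>For leading indices \<open>l < k\<close>, coordinate \<open>k\<close> of a proper
  mixture is a positive multiple, with factor at most 1, of the one at the higher point: closure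
  under shrinking applies. For equal indices, convexity of \<open>J k\<close> does.\<close>

lemma convex_leading:
  assumes J: "\<And>k. convex (J k)" "\<And>k s t. s \<in> J k \<Longrightarrow> 0 < t \<Longrightarrow> t \<le> 1 \<Longrightarrow> t * s \<in> J k"
  shows "convex (leading J)"
proof -
  have main: "u *\<^sub>R x + v *\<^sub>R y \<in> flag k \<inter> {x. coord k x \<in> J k}"
    if "x \<in> flag k" "coord k x \<in> J k" "y \<in> flag l" "coord l y \<in> J l" "l \<le> k" "k \<le> DIM('a)"
      "0 < u" "0 < v" "u + v = 1" for x y u v k l
  proof (cases "l = k")
    case True
    then show ?thesis
      using that convexD[OF J(1), of "coord k x" k "coord k y" u v]
      by (auto simp: flag_def coord_convex_comb)
  next
    case False
    then have "coord k y = 0"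
      using that by (auto simp: flag_def)
    then show ?thesis
      using that J(2)[of "coord k x" k u] by (auto simp: flag_def coord_convex_comb)
  qed
  show ?thesis
  proof (rule convexI)
    fix x y and u v :: real
    assume x: "x \<in> leading J" and y: "y \<in> leading J" and uv: "0 \<le> u" "0 \<le> v" "u + v = 1"
    obtain k where k: "k \<le> DIM('a)" "x \<in> flag k" "coord k x \<in> J k"
      using x by (auto simp: leading_def)
    obtain l where l: "l \<le> DIM('a)" "y \<in> flag l" "coord l y \<in> J l"
      using y by (auto simp: leading_def)
    consider "u = 0" | "v = 0" | "0 < u" "0 < v" "l \<le> k" | "0 < u" "0 < v" "k \<le> l"
      using uv by linarith
    then show "u *\<^sub>R x + v *\<^sub>R y \<in> leading J"
    proof cases
      case 1
      then show ?thesis using uv y by simp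
    next
      case 2
      then show ?thesis using uv x by simp
    next
      case 3
      then show ?thesis
        using main[of x k y l u v] k l uv unfolding leading_def by blast
    next
      case 4
      then show ?thesis
        using main[of y l x k v u] k l uv unfolding leading_def by (auto simp: add.commute)
    qed
  qed
qed

section \<open>The complement as separated pieces, and its strong cover\<close>

definition pieces :: "nat set \<Rightarrow> 'a set" where
  "pieces T = (\<Union>k\<in>T. flag k \<inter> {x. coord k x \<ge> 1})"

text \<open>Each vector has exactly one leading index \<open>k\<close>, with a nonzero value there.
  Both sets miss the vector exactly when that value is positive, \<open>k \<in> T\<close>, and the
  value is not below 1.\<close>

lemma pieces_complement:
  assumes "T \<subseteq> {0..DIM('a)}"
  shows "pieces T =
    UNIV - (leading (\<lambda>k. if k \<in> T then {0<..<1} else {0<..}) \<union> leading (\<lambda>k. {..<0}))"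
proof (rule set_eqI)
  fix x
  obtain k where k: "k \<le> DIM('a)" "x \<in> flag k" "coord k x \<noteq> 0"
    using leading_exists by blast
  have lead: "x \<in> leading J \<longleftrightarrow> coord k x \<in> J k" if "\<And>i. 0 \<notin> J i" for J
  proof -
    have "l = k" if "l \<le> DIM('a)" "x \<in> flag l" "coord l x \<in> J l" for l
      using leading_unique[of l k x] that k \<open>\<And>i. 0 \<notin> J i\<close> by metis
    then show ?thesis
      using k unfolding leading_def by blast
  qed
  have "x \<in> pieces T \<longleftrightarrow> k \<in> T \<and> coord k x \<ge> 1"
  proof -
    have "l = k" if "l \<in> T" "x \<in> flag l" "coord l x \<ge> 1" for l
      using leading_unique[of l k x] that k assms by auto
    then show ?thesis
      using k unfolding pieces_def by blast
  qed
  then show "x \<in> pieces T \<longleftrightarrow>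
    x \<in> UNIV - (leading (\<lambda>k. if k \<in> T then {0<..<1} else {0<..}) \<union> leading (\<lambda>k. {..<0}))"
    using k by (auto simp: lead)
qed

lemma abs_coord_diff_le_dist:
  assumes "i \<le> DIM('a)"
  shows "\<bar>coord i x - coord i y\<bar> \<le> dist x y"
proof (cases "i = 0")
  case False
  then have "b i \<in> Basis"
    using assms b_bij by (auto simp: bij_betw_def)
  then show ?thesis
    using False Basis_le_norm[of "b i" "x - y"] by (simp add: coord_def inner_diff_left dist_norm)
qed (simp add: coord_def)

lemma aff_dim_piece:
  assumes "k \<le> DIM('a)"
  shows "aff_dim (flag k \<inter> {x. coord k x \<ge> 1}) = int k"
proof (cases "k = 0")
  case True
  then show ?thesis
    using aff_dim_flag[of 0] by (simp add: coord_def)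
next
  case False
  let ?U = "{x. coord k x > 1}"
  have "coord k = (\<lambda>x. b k \<bullet> x)"
    using False by (auto simp: coord_def inner_commute)
  then have "open ?U"
    by (simp add: open_halfspace_gt)
  have "b k \<in> Basis"
    using assms False b_bij by (auto simp: bij_betw_def)
  moreover have "b k \<bullet> b i = 0" if "i \<in> {k<..DIM('a)}" for i
  proof -
    have "b i \<in> Basis" "b i \<noteq> b k"
      using that False b_bij assms by (auto simp: bij_betw_def dest: inj_onD)
    then show ?thesis
      using \<open>b k \<in> Basis\<close> by (simp add: inner_not_same_Basis)
  qed
  \<comment> \<open>A witness with coordinate \<open>k\<close> equal to 2: the open half-space meets
    the flag, so the slice has the full dimension.\<close>
  ultimately have "2 *\<^sub>R b k \<in> flag k \<inter> ?U"
    using False by (auto simp: flag_def coord_def)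
  then have "aff_dim (flag k \<inter> ?U) = int k"
    using aff_dim_convex_Int_open[OF _ \<open>open ?U\<close>, of "flag k"] affine_flag[OF assms]
      aff_dim_flag[OF assms] by (auto intro: affine_imp_convex)
  moreover have "aff_dim (flag k \<inter> ?U) \<le> aff_dim (flag k \<inter> {x. coord k x \<ge> 1})"
    by (rule aff_dim_subset) auto
  moreover have "aff_dim (flag k \<inter> {x. coord k x \<ge> 1}) \<le> aff_dim (flag k)"
    by (rule aff_dim_subset) auto
  ultimately show ?thesis
    using aff_dim_flag[OF assms] by simp
qed

lemma convex_piece: "convex (flag k \<inter> {x. coord k x \<ge> 1})"
proof (rule convexI)
  fix x y and u v :: real
  assume *: "x \<in> flag k \<inter> {x. coord k x \<ge> 1}" "y \<in> flag k \<inter> {x. coord k x \<ge> 1}"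
    "0 \<le> u" "0 \<le> v" "u + v = 1"
  have "u * 1 + v * 1 \<le> u * coord k x + v * coord k y"
    using * by (intro add_mono mult_left_mono) auto
  then show "u *\<^sub>R x + v *\<^sub>R y \<in> flag k \<inter> {x. coord k x \<ge> 1}"
    using * by (auto simp: flag_def coord_convex_comb)
qed

text \<open>The unit ball around \<open>x\<close> meets no other piece, and the piece itself is
  convex of affine dimension \<open>k\<close> in every ball around \<open>x\<close>.\<close>

lemma local_dim_pieces:
  assumes T: "T \<subseteq> {0..DIM('a)}" and k: "k \<in> T" and x: "x \<in> flag k" "coord k x \<ge> 1"
  shows "local_dim (pieces T) x = int k"
proof -
  let ?A = "flag k \<inter> {x. coord k x \<ge> 1}"
  have kd: "k \<le> DIM('a)"
    using T k by auto
  have near: "pieces T \<inter> ball x 1 = ?A \<inter> ball x 1"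
  proof -
    have "l = k" if "l \<in> T" "y \<in> flag l" "coord l y \<ge> 1" "dist x y < 1" for l y
    proof (rule ccontr)
      assume "l \<noteq> k"
      have "l \<le> DIM('a)"
        using that T by auto
      \<comment> \<open>At the larger index one point has coordinate at least 1, while the other,
        lying in the smaller flag, has 0.\<close>
      have "\<bar>coord (max k l) x - coord (max k l) y\<bar> \<ge> 1"
        using \<open>l \<noteq> k\<close> that x kd \<open>l \<le> DIM('a)\<close> by (cases "k < l") (auto simp: flag_def)
      then show False
        using abs_coord_diff_le_dist[of "max k l" x y] that kd \<open>l \<le> DIM('a)\<close> by simp
    qed
    then show ?thesis
      using k unfolding pieces_def by auto
  qed
  have small: "flat_dim (?A \<inter> ball x e) = int k" if "e > 0" for e
  proof -
    have "x \<in> ?A \<inter> ball x e"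
      using x that by simp
    then have "aff_dim (?A \<inter> ball x e) = aff_dim ?A"
      by (intro aff_dim_convex_Int_open convex_piece) auto
    then show ?thesis
      using convex_piece[of k] aff_dim_piece[OF kd] by (simp add: flat_dim_convex convex_Int)
  qed
  have "local_dim (pieces T) x \<le> int k"
    using local_dim_le[of 1 "pieces T" x] small[of 1] near by simp
  moreover obtain e where e: "e > 0" "local_dim (pieces T) x = flat_dim (pieces T \<inter> ball x e)"
    using local_dim_attained by blast
  have "?A \<inter> ball x e \<subseteq> pieces T \<inter> ball x e"
    using k by (auto simp: pieces_def)
  then have "int k \<le> local_dim (pieces T) x"
    using flat_dim_mono small[OF e(1)] e(2) by metis
  ultimately show ?thesis by simp
qed

text \<open>Points of piece \<open>k\<close> are covered by \<open>flag k\<close>. For minimality: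
  every piece is nonempty, and no other member of the flag has dimension \<open>k\<close>.\<close>

lemma strong_cover_pieces:
  assumes T: "T \<subseteq> {0..DIM('a)}"
  shows "strong_cover (flag ` T) (pieces T)"
  unfolding strong_cover_def
proof (intro conjI allI impI notI)
  show "finite (flag ` T)"
    using T by (simp add: finite_subset)
  show "\<forall>F\<in>flag ` T. affine F"
    using T affine_flag by auto
  show "covers_strongly (flag ` T) (pieces T)"
    unfolding covers_strongly_def
  proof
    fix x assume "x \<in> pieces T"
    then obtain k where k: "k \<in> T" "x \<in> flag k" "coord k x \<ge> 1"
      by (auto simp: pieces_def)
    then have "is_flat (local_dim (pieces T) x) (flag k)"
      using local_dim_pieces[OF T k] affine_flag aff_dim_flag T by (auto simp: is_flat_def)
    then show "\<exists>F\<in>flag ` T. x \<in> F \<and> is_flat (local_dim (pieces T) x) F"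
      using k by blast
  qed
next
  fix D assume D: "D \<subset> flag ` T" "covers_strongly D (pieces T)"
  then obtain k where k: "k \<in> T" "flag k \<notin> D" by auto
  have kd: "k \<le> DIM('a)"
    using T k by auto
  have "flag k \<inter> {x. coord k x \<ge> 1} \<noteq> {}"
    using aff_dim_piece[OF kd] by force
  then obtain x where x: "x \<in> flag k" "coord k x \<ge> 1" by auto
  then have "x \<in> pieces T"
    using k by (auto simp: pieces_def)
  then obtain F where F: "F \<in> D" "aff_dim F = int k"
    using D(2) local_dim_pieces[OF T k(1) x] by (auto simp: covers_strongly_def is_flat_def)
  then obtain l where "l \<in> T" "F = flag l"
    using D(1) by auto
  then have "l = k"
    using F aff_dim_flag[of l] T by auto
  then show False
    using F k \<open>F = flag l\<close> by simp
qed

end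

section \<open>Prescribed dimensions and the combined statement\<close>

lemma exists_two_convex_strong_cover_dims:
  assumes T: "T \<subseteq> {0..DIM('a::euclidean_space)}"
  shows "\<exists>(K1 :: 'a set) K2 C. convex K1 \<and> convex K2 \<and> strong_cover C (UNIV - (K1 \<union> K2)) \<and>
           (\<forall>k::nat. (\<exists>F\<in>C. is_flat (int k) F) \<longleftrightarrow> k \<in> T)"
proof -
  obtain b :: "nat \<Rightarrow> 'a" where "bij_betw b {1..DIM('a)} Basis"
    using ex_bij_betw_nat_finite_1[OF finite_Basis] by blast
  then interpret basis_enumeration b
    by unfold_locales
  let ?J = "\<lambda>k. if k \<in> T then {0<..<1} else {0<..}"
  \<comment> \<open>The shrinking condition of \<open>convex_leading\<close> for the bounded
    interval.\<close>
  have "t * s < 1" if "0 < s" "s < 1" "0 < t" "t \<le> 1" for s t :: real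
    using mult_strict_mono'[of t 1 s 1] mult_left_le_one_le[of s t] that by linarith
  then have "convex (leading ?J)"
    by (intro convex_leading) (auto split: if_splits)
  moreover have "convex (leading (\<lambda>k. {..<0}))"
    by (intro convex_leading) (auto simp: mult_pos_neg)
  moreover have "strong_cover (flag ` T) (UNIV - (leading ?J \<union> leading (\<lambda>k. {..<0})))"
    using strong_cover_pieces[OF T] pieces_complement[OF T] by simp
  moreover have "(\<exists>F\<in>flag ` T. is_flat (int k) F) \<longleftrightarrow> k \<in> T" for k
  proof -
    have "is_flat (int k) (flag l) \<longleftrightarrow> l = k" if "l \<in> T" for l
      using that T affine_flag[of l] aff_dim_flag[of l] by (auto simp: is_flat_def)
    then show ?thesis by blast
  qed
  ultimately show ?thesis by blast
qed

theorem theorem1p9: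
  shows "(\<forall>(K1 :: 'a::euclidean_space set) K2 C.
            convex K1 \<and> convex K2 \<and> strong_cover C (UNIV - (K1 \<union> K2)) \<longrightarrow>
              (\<forall>I\<in>C. \<forall>J\<in>C. J \<subseteq> I \<or> I \<subseteq> J) \<and>
              (\<forall>k\<in>{0..DIM('a)}. \<forall>I\<in>C. \<forall>J\<in>C. is_flat (int k) I \<and> is_flat (int k) J \<longrightarrow> I = J))
       \<and> (\<forall>T. T \<subseteq> {0..DIM('a)} \<longrightarrow>
            (\<exists>(K1 :: 'a set) K2 C.
              convex K1 \<and> convex K2 \<and> strong_cover C (UNIV - (K1 \<union> K2)) \<and>
              (\<forall>k::nat. (\<exists>F\<in>C. is_flat (int k) F) \<longleftrightarrow> k \<in> T)))"
proof (intro conjI allI impI; (elim conjE)?)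
  fix K1 K2 :: "'a set" and C
  assume *: "convex K1" "convex K2" "strong_cover C (UNIV - (K1 \<union> K2))"
  show chain: "\<forall>I\<in>C. \<forall>J\<in>C. J \<subseteq> I \<or> I \<subseteq> J"
    using strong_cover_two_convex_chain[OF *] by blast
  show "\<forall>k\<in>{0..DIM('a)}. \<forall>I\<in>C. \<forall>J\<in>C. is_flat (int k) I \<and> is_flat (int k) J \<longrightarrow> I = J"
  proof (intro ballI impI)
    fix k I J
    assume IJ: "I \<in> C" "J \<in> C" "is_flat (int k) I \<and> is_flat (int k) J"
    \<comment> \<open>The empty flat has dimension -1. Nested nonempty flats of equal dimension
      coincide.\<close>
    then have "I \<noteq> {}" "J \<noteq> {}"
      by (auto simp: is_flat_def)
    then show "I = J"
      using IJ chain affine_dim_equal[of I J] affine_dim_equal[of J I] unfolding is_flat_def by auto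
  qed
qed (rule exists_two_convex_strong_cover_dims)

end
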